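(* Let $G$ be a finite group of order $k$, let $m=x_{i_1,g_1}x_{i_2,g_2}\cdots x_{i_n,g_n}$ be a strongly multilinear monomial with $g_1,\dots,g_n\in G$, let $\pi\in S_n$, and let $r=\pi(m)$. The following conditions are equivalent: (a) $m$ and $r$ are equivalent. (b) $m$ and $r$ have the same graph. (c) $m-r$ is a $G$-graded identity of $M_k(\mathbb{C})$ (with its $G$-crossed product grading).
   Context: Crossed product grading: let $G$ be a finite group of order $k$, and index the rows and columns of $k\times k$ matrices by the elements of $G$ (with respect to some ordering of $G$). Let $e_h$ ($h\in G$) be the diagonal matrix unit at position $(h,h)$, and let $D_k$ be the set of diagonal matrices in $M_k(\mathbb{C})$. For $g\in G$ let $P_g$ be the permutation matrix sending the standard basis vector indexed by $h$ to the one indexed by $gh$; thus $P_gP_h=P_{gh}$, and $P_g\left(\sum_h a_he_h\right)P_g^{-1}=\sum_h a_he_{gh}$. The $G$-crossed product grading is $M_k(\mathbb{C})=\bigoplus_{g\in G}D_kP_g$, with $g$-component $D_kP_g$. Graded identities: let $\mathbb{Q}\langle X^G\rangle$ be the free associative algebra over $\mathbb{Q}$ on the noncommuting variables $x_{i,g}$, $i\ge1$, $g\in G$. A polynomial in it is a $G$-graded identity for $M_k(\mathbb{C})$ if it vanishes whenever each variable $x_{i,g}$ is replaced by an arbitrary element of $D_kP_g$. A strongly multilinear monomial is a monomial $m=x_{i_1,g_1}\cdots x_{i_n,g_n}$ with $i_1,\dots,i_n$ distinct. For $\pi\in S_n$ put $\pi(m)=x_{i_{\pi(1)},g_{\pi(1)}}\cdots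 x_{i_{\pi(n)},g_{\pi(n)}}$. The permutation $\pi$ is initial product preserving for $m$ if (1) $g_1g_2\cdots g_n=g_{\pi(1)}g_{\pi(2)}\cdots g_{\pi(n)}$, and (2) for every $1\le i\le n$, if $\pi^{-1}(i)=j$ then $g_1g_2\cdots g_i=g_{\pi(1)}g_{\pi(2)}\cdots g_{\pi(j)}$. Two monomials $m$ and $r$ are equivalent if $r=\pi(m)$ for some $\pi$ that is initial product preserving for $m$. The graph of $m$ is the directed graph with vertex set $G$ and $n$ labeled edges: an edge labeled $i_1$ from $e$ to $g_1$ and, for $j>1$, an edge labeled $i_j$ from $g_1\cdots g_{j-1}$ to $g_1\cdots g_j$. Two monomials have the same graph if the sets of edge labels coincide and edges with the same label have the same initial and the same terminal vertex. *)

theory Defs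
  imports
    "HOL-Algebra.Coset"
    "HOL-Combinatorics.Permutations"
    "HOL-Library.Poly_Mapping"
    "Jordan_Normal_Form.Matrix"
    "Graph_Theory.Digraph"
begin

section \<open>Products of lists in a monoid\<close>

definition list_mult :: "('a, 'b) monoid_scheme \<Rightarrow> 'a list \<Rightarrow> 'a" where
  "list_mult M xs = foldr (\<lambda>x y. x \<otimes>\<^bsub>M\<^esub> y) xs \<one>\<^bsub>M\<^esub>"


section \<open>The free associative algebra over the rationals\<close>

text \<open>
  Words form a monoid under concatenation. With this instance, the convolution product of
  \<^theory>\<open>HOL-Library.Poly_Mapping\<close> makes \<^typ>\<open>'v list \<Rightarrow>\<^sub>0 rat\<close> the free associative unital
  algebra over the rationals on the noncommuting variables of type \<^typ>\<open>'v\<close>.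
\<close>

instantiation list :: (type) monoid_add
begin

definition zero_list :: "'a list" where "zero_list = []"

definition plus_list :: "'a list \<Rightarrow> 'a list \<Rightarrow> 'a list" where "plus_list = append"

instance
  by standard (simp_all add: zero_list_def plus_list_def)

end

text \<open>The pair \<open>(i, g)\<close> stands for the variable \<open>x\<^sub>i\<^sub>,\<^sub>g\<close>.\<close>

type_synonym 'g graded_var = "nat \<times> 'g"

type_synonym 'g graded_poly = "'g graded_var list \<Rightarrow>\<^sub>0 rat"

definition graded_vars :: "('g, 'b) monoid_scheme \<Rightarrow> 'g graded_var set" where
  "graded_vars G = {(i, g). 1 \<le> i \<and> g \<in> carrier G}"

definition free_graded_algebra :: "('g, 'b) monoid_scheme \<Rightarrow> 'g graded_poly set" where
  "free_graded_algebra G = {f. \<forall>w \<in> Poly_Mapping.keys f. set w \<subseteq> graded_vars G}"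

definition var :: "'g graded_var \<Rightarrow> 'g graded_poly" where
  "var x = Poly_Mapping.single [x] 1"

text \<open>A word \<open>w\<close>, read as the monomial that is the product of its letters.\<close>

definition monomial :: "'g graded_var list \<Rightarrow> 'g graded_poly" where
  "monomial w = prod_list (map var w)"


section \<open>The crossed product grading\<close>

text \<open>
  In this section \<open>\<phi>\<close> enumerates \<open>carrier G\<close> by \<open>{..<order G}\<close>: row and column number \<open>a\<close>
  belong to the group element \<open>\<phi> a\<close>.
\<close>

abbreviation matrix_algebra :: "('g, 'b) monoid_scheme \<Rightarrow> complex mat ring" where
  "matrix_algebra G \<equiv> ring_mat TYPE(complex) (order G) ()"

definition diagonal_matrices :: "nat \<Rightarrow> complex mat set" where
  "diagonal_matrices k = {A \<in> carrier_mat k k. diagonal_mat A}"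

definition group_perm_mat :: "('g, 'b) monoid_scheme \<Rightarrow> (nat \<Rightarrow> 'g) \<Rightarrow> 'g \<Rightarrow> complex mat" where
  "group_perm_mat G \<phi> g =
    mat (order G) (order G) (\<lambda>(a, b). if \<phi> a = g \<otimes>\<^bsub>G\<^esub> \<phi> b then 1 else 0)"

definition crossed_component ::
    "('g, 'b) monoid_scheme \<Rightarrow> (nat \<Rightarrow> 'g) \<Rightarrow> 'g \<Rightarrow> complex mat set" where
  "crossed_component G \<phi> g = (\<lambda>A. A * group_perm_mat G \<phi> g) ` diagonal_matrices (order G)"

definition poly_eval ::
    "('g, 'b) monoid_scheme \<Rightarrow> ('g graded_var \<Rightarrow> complex mat) \<Rightarrow> 'g graded_poly \<Rightarrow> complex mat" where
  "poly_eval G s f =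
    (\<Oplus>\<^bsub>matrix_algebra G\<^esub> w \<in> Poly_Mapping.keys f.
       of_rat (Poly_Mapping.lookup f w) \<cdot>\<^sub>m list_mult (matrix_algebra G) (map s w))"

definition graded_identity ::
    "('g, 'b) monoid_scheme \<Rightarrow> (nat \<Rightarrow> 'g) \<Rightarrow> 'g graded_poly \<Rightarrow> bool" where
  "graded_identity G \<phi> f \<longleftrightarrow>
    f \<in> free_graded_algebra G \<and>
    (\<forall>s. (\<forall>(i, g) \<in> graded_vars G. s (i, g) \<in> crossed_component G \<phi> g) \<longrightarrow>
       poly_eval G s f = 0\<^sub>m (order G) (order G))"


section \<open>Strongly multilinear monomials\<close>

definition strongly_multilinear :: "('g, 'b) monoid_scheme \<Rightarrow> 'g graded_var list \<Rightarrow> bool" where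
  "strongly_multilinear G m \<longleftrightarrow> set m \<subseteq> graded_vars G \<and> distinct (map fst m)"

text \<open>The product \<open>g\<^sub>1 \<cdots> g\<^sub>j\<close> of the degrees of the first \<open>j\<close> letters.\<close>

definition initial_product :: "('g, 'b) monoid_scheme \<Rightarrow> 'g graded_var list \<Rightarrow> nat \<Rightarrow> 'g" where
  "initial_product G m j = list_mult G (map snd (take j m))"

text \<open>
  Positions are counted from 0, so a permutation of the letters of \<open>m\<close> is a permutation of
  \<open>{..<length m}\<close>, and letter number \<open>j\<close> of \<open>permute_list \<pi> m\<close> is \<open>m ! \<pi> j\<close>. The initial
  product ending with the letter at position \<open>i\<close> is \<open>initial_product G m (Suc i)\<close>.
\<close>

definition initial_product_preserving ::
    "('g, 'b) monoid_scheme \<Rightarrow> 'g graded_var list \<Rightarrow> (nat \<Rightarrow> nat) \<Rightarrow> bool" where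
  "initial_product_preserving G m \<pi> \<longleftrightarrow>
    \<pi> permutes {..<length m} \<and>
    list_mult G (map snd m) = list_mult G (map snd (permute_list \<pi> m)) \<and>
    (\<forall>i < length m. \<forall>j. inv_into UNIV \<pi> i = j \<longrightarrow>
       initial_product G m (Suc i) = initial_product G (permute_list \<pi> m) (Suc j))"

definition equivalent_monomials ::
    "('g, 'b) monoid_scheme \<Rightarrow> 'g graded_var list \<Rightarrow> 'g graded_var list \<Rightarrow> bool" where
  "equivalent_monomials G m r \<longleftrightarrow>
    (\<exists>\<pi>. initial_product_preserving G m \<pi> \<and> r = permute_list \<pi> m)"

text \<open>An arc \<open>(l, u, v)\<close> is the edge labeled \<open>l\<close> from \<open>u\<close> to \<open>v\<close>.\<close>

definition monomial_graph ::
    "('g, 'b) monoid_scheme \<Rightarrow> 'g graded_var list \<Rightarrow> ('g, nat \<times> 'g \<times> 'g) pre_digraph" where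
  "monomial_graph G m =
    \<lparr> verts = carrier G,
      arcs = (\<lambda>j. (fst (m ! j), initial_product G m j, initial_product G m (Suc j))) ` {..<length m},
      tail = (\<lambda>(l, u, v). u),
      head = (\<lambda>(l, u, v). v) \<rparr>"

definition same_graph ::
    "('g, 'b) monoid_scheme \<Rightarrow> 'g graded_var list \<Rightarrow> 'g graded_var list \<Rightarrow> bool" where
  "same_graph G m r \<longleftrightarrow>
    fst ` arcs (monomial_graph G m) = fst ` arcs (monomial_graph G r) \<and>
    (\<forall>a \<in> arcs (monomial_graph G m). \<forall>b \<in> arcs (monomial_graph G r).
       fst a = fst b \<longrightarrow>
         tail (monomial_graph G m) a = tail (monomial_graph G r) b \<and>
         head (monomial_graph G m) a = head (monomial_graph G r) b)"

end

theory Submission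
  imports Defs
begin

text \<open>
  All three conditions say the same thing about where the letters stand: a letter has the same
  initial product in front of it in \<open>r\<close> as in \<open>m\<close>, that is, its edge starts at the same vertex in
  both graphs.

  For the graph this is clear, because a letter has the same degree in \<open>m\<close> and in \<open>r\<close>, so its edge
  ends at the same vertex as soon as it starts at the same vertex. Equivalence of monomials speaks
  of the end points instead, but asks in addition that the total products agree. This follows from
  the rest: \<open>m\<close> and \<open>r\<close> are walks from \<open>\<one>\<close> which use the same edges, and the end of a walk is
  determined by its start and by how often each vertex begins and ends an edge
  (\<open>walk_end_determined_by_edges\<close>).

  For the identities, an element of the component of degree \<open>g\<close> is a matrix whose entry at
  \<open>(h, h')\<close> is \<open>d h\<close> if \<open>h = g h'\<close>, and \<open>0\<close> otherwise. By \<open>list_mult_graded_mat\<close>, a product of such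
  matrices has the same shape, where the degree is the total product and row \<open>h\<close> holds the product of
  the values \<open>d\<^sub>j (p\<^sub>j\<inverse> h)\<close>, with \<open>p\<^sub>j\<close> the initial product in front of letter \<open>j\<close>. So the value of a
  monomial depends only on its total product and on the initial product in front of each letter,
  which gives one direction. Conversely, row \<open>\<one>\<close> detects \<open>p\<^sub>j\<close>: let \<open>d\<^sub>j\<close> be the indicator function of
  \<open>p\<^sub>j\<inverse>\<close> and let all other \<open>d\<^sub>i\<close> be constantly \<open>1\<close>. Then \<open>m\<close> has a nonzero entry in row \<open>\<one>\<close>, and
  this entry can be nonzero for \<open>r\<close> only if letter \<open>j\<close> is preceded by \<open>p\<^sub>j\<close> in \<open>r\<close> too.
\<close>

section \<open>Initial products and graphs of monomials\<close>

lemma list_mult_Nil [simp]: "list_mult M [] = \<one>\<^bsub>M\<^esub>"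
  by (simp add: list_mult_def)

lemma list_mult_Cons [simp]: "list_mult M (x # xs) = x \<otimes>\<^bsub>M\<^esub> list_mult M xs"
  by (simp add: list_mult_def)

lemma (in monoid) list_mult_closed: "set xs \<subseteq> carrier G \<Longrightarrow> list_mult G xs \<in> carrier G"
  by (induction xs) auto

lemma (in monoid) list_mult_snoc:
  "set xs \<subseteq> carrier G \<Longrightarrow> x \<in> carrier G \<Longrightarrow> list_mult G (xs @ [x]) = list_mult G xs \<otimes> x"
  by (induction xs) (auto simp: m_assoc list_mult_closed)

lemma initial_product_0 [simp]: "initial_product G w 0 = \<one>\<^bsub>G\<^esub>"
  by (simp add: initial_product_def)

lemma initial_product_Cons_Suc [simp]:
  "initial_product G (x # w) (Suc j) = snd x \<otimes>\<^bsub>G\<^esub> initial_product G w j"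
  by (simp add: initial_product_def)

lemma initial_product_length [simp]:
  "initial_product G w (length w) = list_mult G (map snd w)"
  by (simp add: initial_product_def)

lemma (in monoid) initial_product_closed:
  "snd ` set w \<subseteq> carrier G \<Longrightarrow> initial_product G w j \<in> carrier G"
  unfolding initial_product_def by (rule list_mult_closed) (auto dest: in_set_takeD)

lemma (in monoid) initial_product_Suc:
  assumes "snd ` set w \<subseteq> carrier G" "j < length w"
  shows "initial_product G w (Suc j) = initial_product G w j \<otimes> snd (w ! j)"
proof -
  have "set (map snd (take j w)) \<subseteq> carrier G" "snd (w ! j) \<in> carrier G"
    using assms by (auto dest: in_set_takeD)
  then show ?thesis
    using assms(2) by (simp add: initial_product_def take_Suc_conv_app_nth list_mult_snoc)
qed

lemma same_graph_permute_list:
  assumes "distinct (map fst m)" "\<pi> permutes {..<length m}"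
  shows "same_graph G m (permute_list \<pi> m) \<longleftrightarrow>
    (\<forall>j < length m.
       initial_product G m (\<pi> j) = initial_product G (permute_list \<pi> m) j \<and>
       initial_product G m (Suc (\<pi> j)) = initial_product G (permute_list \<pi> m) (Suc j))"
proof -
  define r where "r = permute_list \<pi> m"
  have len: "length r = length m"
    by (simp add: r_def)
  have r_nth: "r ! j = m ! \<pi> j" and \<pi>_less: "\<pi> j < length m" if "j < length m" for j
    using that assms(2) permutes_in_image[OF assms(2), of j] by (simp_all add: r_def permute_list_nth)
  have "fst ` arcs (monomial_graph G w) = set (map fst w)" for w
    by (force simp: monomial_graph_def in_set_conv_nth image_image)
  moreover have "set (map fst m) = set (map fst r)"
    using assms(2) by (simp add: r_def)
  ultimately have labels: "fst ` arcs (monomial_graph G m) = fst ` arcs (monomial_graph G r)"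
    by metis
  have "same_graph G m r \<longleftrightarrow> (\<forall>i < length m. \<forall>j < length m. fst (m ! i) = fst (r ! j) \<longrightarrow>
      initial_product G m i = initial_product G r j \<and>
      initial_product G m (Suc i) = initial_product G r (Suc j))"
    unfolding same_graph_def
    by (simp only: labels simp_thms, simp add: monomial_graph_def len, simp add: Ball_def)
  \<comment> \<open>The labels are distinct, so edge \<open>j\<close> of \<open>r\<close> can share its label only with edge \<open>\<pi> j\<close> of \<open>m\<close>.\<close>
  moreover have "fst (m ! i) = fst (r ! j) \<longleftrightarrow> i = \<pi> j" if "i < length m" "j < length m" for i j
    using that nth_eq_iff_index_eq[OF assms(1), of i "\<pi> j"] by (simp add: r_nth \<pi>_less)
  ultimately show ?thesis
    unfolding r_def[symmetric] using \<pi>_less by metis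
qed

text \<open>
  The degree of a letter is the quotient of its two end points, so one end point of each edge
  suffices to compare the graphs.
\<close>

lemma (in group) same_graph_iff_end_points:
  assumes "distinct (map fst m)" "snd ` set m \<subseteq> carrier G" "\<pi> permutes {..<length m}"
  shows "same_graph G m (permute_list \<pi> m) \<longleftrightarrow>
    (\<forall>j < length m.
       initial_product G m (Suc (\<pi> j)) = initial_product G (permute_list \<pi> m) (Suc j))" (is ?heads)
    and "same_graph G m (permute_list \<pi> m) \<longleftrightarrow>
    (\<forall>j < length m.
       initial_product G m (\<pi> j) = initial_product G (permute_list \<pi> m) j)" (is ?tails)
proof -
  have carrier_r: "snd ` set (permute_list \<pi> m) \<subseteq> carrier G"
    using assms by simp
  have "initial_product G m (Suc (\<pi> j)) = initial_product G (permute_list \<pi> m) (Suc j) \<longleftrightarrow>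
      initial_product G m (\<pi> j) = initial_product G (permute_list \<pi> m) j"
    if "j < length m" for j
  proof -
    have less: "\<pi> j < length m"
      using that permutes_in_image[OF assms(3), of j] by simp
    then have "snd (m ! \<pi> j) \<in> carrier G"
      using assms(2) by auto
    then show ?thesis
      using that less assms carrier_r
      by (simp add: initial_product_Suc permute_list_nth initial_product_closed right_cancel)
  qed
  then show ?heads ?tails
    using same_graph_permute_list[OF assms(1,3)] by blast+
qed

section \<open>Equivalence and graphs\<close>

text \<open>
  Each vertex of a walk, counted with multiplicity, is the start of the walk or the end of an edge,
  and also the end of the walk or the start of an edge. Two walks which start together and use the
  same edges in a different order therefore end together.
\<close>

lemma walk_end_determined_by_edges:
  fixes f f' :: "nat \<Rightarrow> 'a"
  assumes "f 0 = f' 0" "\<pi> permutes {..<n}"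
    and "\<And>j. j < n \<Longrightarrow> f (\<pi> j) = f' j" "\<And>j. j < n \<Longrightarrow> f (Suc (\<pi> j)) = f' (Suc j)"
  shows "f n = f' n"
proof -
  have balance: "add_mset (u n) (image_mset u (mset_set {..<n})) =
      add_mset (u 0) (image_mset (\<lambda>j. u (Suc j)) (mset_set {..<n}))" for u :: "nat \<Rightarrow> 'a"
    by (induction n) (auto simp: lessThan_Suc add_mset_commute)
  have perm: "image_mset (\<lambda>j. u (\<pi> j)) (mset_set {..<n}) = image_mset u (mset_set {..<n})"
    for u :: "nat \<Rightarrow> 'a"
  proof -
    have "image_mset \<pi> (mset_set {..<n}) = mset_set {..<n}"
      using assms(2) by (simp add: image_mset_mset_set permutes_inj_on permutes_image)
    then show ?thesis
      by (metis (no_types, lifting) comp_def image_mset.compositionality image_mset_cong)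
  qed
  have "image_mset f' (mset_set {..<n}) = image_mset f (mset_set {..<n})"
    unfolding perm[of f, symmetric] by (rule image_mset_cong) (simp add: assms(3))
  moreover have "image_mset (\<lambda>j. f' (Suc j)) (mset_set {..<n}) =
      image_mset (\<lambda>j. f (Suc j)) (mset_set {..<n})"
    unfolding perm[of "\<lambda>j. f (Suc j)", symmetric] by (rule image_mset_cong) (simp add: assms(4))
  ultimately have "add_mset (f n) (image_mset f (mset_set {..<n})) =
      add_mset (f' n) (image_mset f (mset_set {..<n}))"
    using balance[of f] balance[of f'] assms(1) by simp
  then show ?thesis
    by simp
qed

lemma same_graph_imp_same_total:
  assumes "distinct (map fst m)" "\<pi> permutes {..<length m}" "same_graph G m (permute_list \<pi> m)"
  shows "list_mult G (map snd m) = list_mult G (map snd (permute_list \<pi> m))"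
proof -
  have "initial_product G m (length m) = initial_product G (permute_list \<pi> m) (length m)"
    by (rule walk_end_determined_by_edges[where \<pi> = \<pi>])
      (use assms in \<open>auto simp: same_graph_permute_list\<close>)
  then show ?thesis
    using initial_product_length[of G "permute_list \<pi> m"] by simp
qed

lemma (in group) initial_product_preserving_iff_same_graph:
  assumes "distinct (map fst m)" "snd ` set m \<subseteq> carrier G" "\<pi> permutes {..<length m}"
  shows "initial_product_preserving G m \<pi> \<longleftrightarrow> same_graph G m (permute_list \<pi> m)"
proof -
  have "(\<forall>i < length m. \<forall>j. inv_into UNIV \<pi> i = j \<longrightarrow>
          initial_product G m (Suc i) = initial_product G (permute_list \<pi> m) (Suc j)) \<longleftrightarrow>
      (\<forall>j < length m.
          initial_product G m (Suc (\<pi> j)) = initial_product G (permute_list \<pi> m) (Suc j))"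
    using permutes_inverses[OF assms(3)] permutes_in_image[OF assms(3)]
    by (metis lessThan_iff)
  then show ?thesis
    using assms same_graph_imp_same_total[OF assms(1,3), of G]
    by (auto simp: initial_product_preserving_def same_graph_iff_end_points(1)[OF assms])
qed

text \<open>
  Equivalence may be witnessed by a permutation other than \<open>\<pi>\<close>. This is harmless, since the graph
  depends only on the permuted list.
\<close>

lemma (in group) equivalent_monomials_iff_same_graph:
  assumes "distinct (map fst m)" "snd ` set m \<subseteq> carrier G" "\<pi> permutes {..<length m}"
  shows "equivalent_monomials G m (permute_list \<pi> m) \<longleftrightarrow> same_graph G m (permute_list \<pi> m)"
  unfolding equivalent_monomials_def
  using initial_product_preserving_iff_same_graph[OF assms(1,2)] assms(3)
  by (metis initial_product_preserving_def)

section \<open>Products of homogeneous matrices\<close>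

text \<open>
  This is \<open>(\<Sum>\<^sub>h d\<^sub>h e\<^sub>h) P\<^sub>g\<close>. The diagonal is a function on group elements instead of row numbers, so
  that it can be translated by the group.
\<close>

definition graded_mat ::
    "('g, 'b) monoid_scheme \<Rightarrow> (nat \<Rightarrow> 'g) \<Rightarrow> 'g \<Rightarrow> ('g \<Rightarrow> complex) \<Rightarrow> complex mat" where
  "graded_mat G \<phi> g d =
    mat (order G) (order G) (\<lambda>(a, b). if \<phi> a = g \<otimes>\<^bsub>G\<^esub> \<phi> b then d (\<phi> a) else 0)"

lemma graded_mat_carrier [simp]: "graded_mat G \<phi> g d \<in> carrier_mat (order G) (order G)"
  by (simp add: graded_mat_def)

lemma diagonal_mult_group_perm_mat:
  assumes "A \<in> diagonal_matrices (order G)" "\<And>a. a < order G \<Longrightarrow> A $$ (a, a) = d (\<phi> a)"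
  shows "A * group_perm_mat G \<phi> g = graded_mat G \<phi> g d"
proof (rule eq_matI)
  have A: "A \<in> carrier_mat (order G) (order G)" "diagonal_mat A"
    using assms(1) by (auto simp: diagonal_matrices_def)
  show "dim_row (A * group_perm_mat G \<phi> g) = dim_row (graded_mat G \<phi> g d)"
    "dim_col (A * group_perm_mat G \<phi> g) = dim_col (graded_mat G \<phi> g d)"
    using A by (auto simp: group_perm_mat_def graded_mat_def)
  fix a b assume "a < dim_row (graded_mat G \<phi> g d)" "b < dim_col (graded_mat G \<phi> g d)"
  then have ab: "a < order G" "b < order G"
    by (auto simp: graded_mat_def)
  have "(A * group_perm_mat G \<phi> g) $$ (a, b) =
      (\<Sum>c \<in> {0..<order G}. A $$ (a, c) * group_perm_mat G \<phi> g $$ (c, b))"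
    using A ab by (simp add: group_perm_mat_def scalar_prod_def)
  also have "\<dots> = (\<Sum>c \<in> {0..<order G}.
      if c = a then A $$ (a, a) * group_perm_mat G \<phi> g $$ (a, b) else 0)"
    using A ab by (intro sum.cong) (auto simp: diagonal_mat_def)
  also have "\<dots> = graded_mat G \<phi> g d $$ (a, b)"
    using ab assms(2) by (simp add: group_perm_mat_def graded_mat_def)
  finally show "(A * group_perm_mat G \<phi> g) $$ (a, b) = graded_mat G \<phi> g d $$ (a, b)" .
qed

locale enumerated_group = group G for G :: "('g, 'b) monoid_scheme" (structure) +
  fixes \<phi> :: "nat \<Rightarrow> 'g"
  assumes enum: "bij_betw \<phi> {..<order G} (carrier G)"
begin

lemma enum_closed [simp]: "a < order G \<Longrightarrow> \<phi> a \<in> carrier G"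
  using bij_betwE[OF enum] by auto

lemma enum_eq_iff [simp]: "a < order G \<Longrightarrow> b < order G \<Longrightarrow> \<phi> a = \<phi> b \<longleftrightarrow> a = b"
  using enum by (auto simp: bij_betw_def inj_on_def)

lemma obtain_index:
  assumes "h \<in> carrier G"
  obtains a where "a < order G" "\<phi> a = h"
  using assms enum that by (metis bij_betw_def imageE lessThan_iff)

lemma graded_mat_cong:
  assumes "\<And>h. h \<in> carrier G \<Longrightarrow> d h = d' h"
  shows "graded_mat G \<phi> g d = graded_mat G \<phi> g d'"
  unfolding graded_mat_def by (rule cong_mat) (simp_all, metis assms enum_closed)

lemma crossed_component_eq_graded_mats: "crossed_component G \<phi> g = range (graded_mat G \<phi> g)"
proof (intro equalityI subsetI)
  fix M assume "M \<in> crossed_component G \<phi> g"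
  then obtain A where A: "A \<in> diagonal_matrices (order G)" "M = A * group_perm_mat G \<phi> g"
    by (auto simp: crossed_component_def)
  have "inv_into {..<order G} \<phi> (\<phi> a) = a" if "a < order G" for a
    using that enum by (simp add: bij_betw_def inv_into_f_f)
  then have "M = graded_mat G \<phi> g
      (\<lambda>h. A $$ (inv_into {..<order G} \<phi> h, inv_into {..<order G} \<phi> h))"
    using A by (simp add: diagonal_mult_group_perm_mat)
  then show "M \<in> range (graded_mat G \<phi> g)"
    by blast
next
  fix M assume "M \<in> range (graded_mat G \<phi> g)"
  then obtain d where M: "M = graded_mat G \<phi> g d"
    by blast
  define A where "A = mat (order G) (order G) (\<lambda>(a, b). if a = b then d (\<phi> a) else 0)"
  have A: "A \<in> diagonal_matrices (order G)"
    by (auto simp: A_def diagonal_matrices_def diagonal_mat_def)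
  moreover have "A * group_perm_mat G \<phi> g = M"
    unfolding M by (rule diagonal_mult_group_perm_mat[OF A]) (simp add: A_def)
  ultimately show "M \<in> crossed_component G \<phi> g"
    unfolding crossed_component_def by blast
qed

lemma one_mat_eq_graded_mat: "1\<^sub>m (order G) = graded_mat G \<phi> \<one> (\<lambda>_. 1)"
  by (auto simp: graded_mat_def intro!: eq_matI)

text \<open>
  This is the commutation rule \<open>P\<^sub>g (\<Sum>\<^sub>h d'\<^sub>h e\<^sub>h) P\<^sub>g\<inverse> = \<Sum>\<^sub>h d'\<^sub>h e\<^sub>g\<^sub>h\<close>: moving \<open>P\<^sub>g\<close> to the right translates
  the second diagonal matrix by \<open>g\<close>.
\<close>

lemma graded_mat_mult:
  assumes "g \<in> carrier G" "g' \<in> carrier G"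
  shows "graded_mat G \<phi> g d * graded_mat G \<phi> g' d' =
    graded_mat G \<phi> (g \<otimes> g') (\<lambda>h. d h * d' (inv g \<otimes> h))"
proof (rule eq_matI)
  fix a b
  assume "a < dim_row (graded_mat G \<phi> (g \<otimes> g') (\<lambda>h. d h * d' (inv g \<otimes> h)))"
    "b < dim_col (graded_mat G \<phi> (g \<otimes> g') (\<lambda>h. d h * d' (inv g \<otimes> h)))"
  then have ab: "a < order G" "b < order G"
    by (auto simp: graded_mat_def)
  \<comment> \<open>In row \<open>a\<close> the first factor is supported in the single column \<open>c0\<close>.\<close>
  obtain c0 where c0: "c0 < order G" "\<phi> c0 = inv g \<otimes> \<phi> a"
    using obtain_index[of "inv g \<otimes> \<phi> a"] assms ab by auto
  have col: "\<phi> a = g \<otimes> \<phi> c \<longleftrightarrow> c = c0" if "c < order G" for c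
    using that assms ab c0 inv_solve_left[of "\<phi> c" g "\<phi> a"] enum_eq_iff[OF that c0(1)] by auto
  have "(graded_mat G \<phi> g d * graded_mat G \<phi> g' d') $$ (a, b) =
      (\<Sum>c \<in> {0..<order G}. graded_mat G \<phi> g d $$ (a, c) * graded_mat G \<phi> g' d' $$ (c, b))"
    using ab by (simp add: graded_mat_def scalar_prod_def)
  also have "\<dots> = (\<Sum>c \<in> {0..<order G}.
      if c = c0 then d (\<phi> a) * graded_mat G \<phi> g' d' $$ (c0, b) else 0)"
    using ab by (intro sum.cong) (auto simp: graded_mat_def col)
  also have "\<dots> = (if \<phi> c0 = g' \<otimes> \<phi> b then d (\<phi> a) * d' (\<phi> c0) else 0)"
    using ab c0 by (simp add: graded_mat_def)
  also have "\<phi> c0 = g' \<otimes> \<phi> b \<longleftrightarrow> \<phi> a = g \<otimes> g' \<otimes> \<phi> b"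
    using assms ab c0 inv_solve_left'[of "g' \<otimes> \<phi> b" g "\<phi> a"] by (auto simp: m_assoc)
  finally show "(graded_mat G \<phi> g d * graded_mat G \<phi> g' d') $$ (a, b) =
      graded_mat G \<phi> (g \<otimes> g') (\<lambda>h. d h * d' (inv g \<otimes> h)) $$ (a, b)"
    using ab c0 by (simp add: graded_mat_def)
qed (simp_all add: graded_mat_def)

text \<open>
  Moving all permutation matrices to the right collects the total product there, and the diagonal
  of each letter is translated by the permutation matrices that stand in front of it, hence by its
  initial product.
\<close>

lemma list_mult_graded_mat:
  assumes "snd ` set w \<subseteq> carrier G" "\<And>x. x \<in> set w \<Longrightarrow> s x = graded_mat G \<phi> (snd x) (d x)"
  shows "list_mult (matrix_algebra G) (map s w) = graded_mat G \<phi> (list_mult G (map snd w))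
    (\<lambda>h. \<Prod>j < length w. d (w ! j) (inv (initial_product G w j) \<otimes> h))"
  using assms
proof (induction w)
  case Nil
  then show ?case
    by (simp add: ring_mat_simps one_mat_eq_graded_mat)
next
  case (Cons x w)
  let ?D = "\<lambda>h. \<Prod>j < length w. d (w ! j) (inv (initial_product G w j) \<otimes> h)"
  have x: "snd x \<in> carrier G" and w: "snd ` set w \<subseteq> carrier G"
    using Cons.prems by auto
  have total: "list_mult G (map snd w) \<in> carrier G"
    using w by (intro list_mult_closed) auto
  have "list_mult (matrix_algebra G) (map s (x # w)) =
      graded_mat G \<phi> (snd x) (d x) * graded_mat G \<phi> (list_mult G (map snd w)) ?D"
    using Cons by (simp add: ring_mat_simps)
  also have "\<dots> = graded_mat G \<phi> (list_mult G (map snd (x # w)))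
      (\<lambda>h. d x h * ?D (inv (snd x) \<otimes> h))"
    using x total by (simp add: graded_mat_mult)
  also have "\<dots> = graded_mat G \<phi> (list_mult G (map snd (x # w)))
      (\<lambda>h. \<Prod>j < length (x # w). d ((x # w) ! j) (inv (initial_product G (x # w) j) \<otimes> h))"
  proof (rule graded_mat_cong)
    fix h assume "h \<in> carrier G"
    then show "d x h * ?D (inv (snd x) \<otimes> h) =
        (\<Prod>j < length (x # w). d ((x # w) ! j) (inv (initial_product G (x # w) j) \<otimes> h))"
      using x w
      by (simp add: prod.lessThan_Suc_shift initial_product_closed inv_mult_group m_assoc
          del: prod.lessThan_Suc)
  qed
  finally show ?case .
qed

end

section \<open>Evaluation of binomials\<close>

lemma monomial_eq_single: "monomial w = Poly_Mapping.single w 1"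
proof (induction w)
  case Nil
  have "monomial [] = Poly_Mapping.single (0 :: 'a graded_var list) 1"
    by (simp add: monomial_def)
  then show ?case
    by (simp add: zero_list_def)
next
  case (Cons x w)
  have "monomial (x # w) = var x * monomial w"
    by (simp add: monomial_def)
  then show ?case
    by (simp add: Cons.IH var_def mult_single plus_list_def)
qed

lemma poly_eval_monomial_diff:
  fixes G :: "('g, 'b) monoid_scheme"
  assumes "list_mult (matrix_algebra G) (map s m) \<in> carrier_mat (order G) (order G)"
    and "list_mult (matrix_algebra G) (map s r) \<in> carrier_mat (order G) (order G)"
  shows "poly_eval G s (monomial m - monomial r) =
    list_mult (matrix_algebra G) (map s m) - list_mult (matrix_algebra G) (map s r)"
proof -
  interpret M: ring "matrix_algebra G"
    by (rule ring_mat)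
  have carr: "carrier (matrix_algebra G) = carrier_mat (order G) (order G)"
    by (simp add: ring_mat_simps)
  show ?thesis
  proof (cases "m = r")
    case True
    then show ?thesis
      using assms by (simp add: poly_eval_def ring_mat_simps)
  next
    case False
    have lookup: "Poly_Mapping.lookup (monomial m - monomial r) w =
        (if w = m then 1 else if w = r then - 1 else 0)" for w
      using False by (auto simp: monomial_eq_single lookup_minus lookup_single when_def)
    then have "Poly_Mapping.keys (monomial m - monomial r) = {m, r}"
      using False by (auto simp: in_keys_iff split: if_splits)
    then have "poly_eval G s (monomial m - monomial r) =
        1 \<cdot>\<^sub>m list_mult (matrix_algebra G) (map s m) \<oplus>\<^bsub>matrix_algebra G\<^esub>
        (- 1) \<cdot>\<^sub>m list_mult (matrix_algebra G) (map s r)"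
      using assms False by (simp add: poly_eval_def lookup carr of_rat_minus)
    also have "\<dots> = list_mult (matrix_algebra G) (map s m) - list_mult (matrix_algebra G) (map s r)"
      using assms by (auto simp: ring_mat_simps intro!: eq_matI)
    finally show ?thesis .
  qed
qed

context enumerated_group
begin

text \<open>
  Choosing a graded substitution amounts to choosing a diagonal for each variable without any
  constraint, so an identity between two monomials is an identity between their values in these
  diagonals.
\<close>

lemma graded_identity_monomial_diff_iff:
  assumes "set m \<subseteq> graded_vars G" "set r \<subseteq> graded_vars G"
  shows "graded_identity G \<phi> (monomial m - monomial r) \<longleftrightarrow>
    (\<forall>d. graded_mat G \<phi> (list_mult G (map snd m))
          (\<lambda>h. \<Prod>j < length m. d (m ! j) (inv (initial_product G m j) \<otimes> h)) =
        graded_mat G \<phi> (list_mult G (map snd r))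
          (\<lambda>h. \<Prod>j < length r. d (r ! j) (inv (initial_product G r j) \<otimes> h)))"
    (is "_ \<longleftrightarrow> (\<forall>d. ?value m d = ?value r d)")
proof -
  have degrees: "snd ` set m \<subseteq> carrier G" "snd ` set r \<subseteq> carrier G"
    using assms by (auto simp: graded_vars_def)
  have eval: "poly_eval G s (monomial m - monomial r) = ?value m d - ?value r d"
    if "\<And>x. x \<in> graded_vars G \<Longrightarrow> s x = graded_mat G \<phi> (snd x) (d x)"
    for s and d :: "'g graded_var \<Rightarrow> 'g \<Rightarrow> complex"
  proof -
    have "list_mult (matrix_algebra G) (map s m) = ?value m d"
      "list_mult (matrix_algebra G) (map s r) = ?value r d"
      using that assms degrees by (auto intro!: list_mult_graded_mat)
    then show ?thesis
      by (simp add: poly_eval_monomial_diff)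
  qed
  have diff_zero: "A - B = 0\<^sub>m (order G) (order G) \<longleftrightarrow> A = B"
    if "A \<in> carrier_mat (order G) (order G)" "B \<in> carrier_mat (order G) (order G)"
    for A B :: "complex mat"
  proof
    assume diff: "A - B = 0\<^sub>m (order G) (order G)"
    show "A = B"
    proof (rule eq_matI)
      fix a b assume ab: "a < dim_row B" "b < dim_col B"
      then have "(A - B) $$ (a, b) = 0"
        using that diff by simp
      then show "A $$ (a, b) = B $$ (a, b)"
        using that ab by simp
    qed (use that in auto)
  qed (use that in auto)
  have "Poly_Mapping.keys (monomial m - monomial r) \<subseteq> {m, r}"
    by (auto simp: monomial_eq_single lookup_minus lookup_single in_keys_iff when_def
        split: if_splits)
  then have free: "monomial m - monomial r \<in> free_graded_algebra G"
    using assms by (auto simp: free_graded_algebra_def)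
  show ?thesis
  proof
    assume identity: "graded_identity G \<phi> (monomial m - monomial r)"
    show "\<forall>d. ?value m d = ?value r d"
    proof
      fix d :: "'g graded_var \<Rightarrow> 'g \<Rightarrow> complex"
      define s where "s = (\<lambda>x. graded_mat G \<phi> (snd x) (d x))"
      have "\<forall>(i, g) \<in> graded_vars G. s (i, g) \<in> crossed_component G \<phi> g"
        by (auto simp: s_def crossed_component_eq_graded_mats)
      then have "poly_eval G s (monomial m - monomial r) = 0\<^sub>m (order G) (order G)"
        using identity by (simp add: graded_identity_def)
      moreover have "poly_eval G s (monomial m - monomial r) = ?value m d - ?value r d"
        by (rule eval) (simp add: s_def)
      ultimately have "?value m d - ?value r d = 0\<^sub>m (order G) (order G)"
        by metis
      then show "?value m d = ?value r d"
        by (simp only: diff_zero graded_mat_carrier)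
    qed
  next
    assume eq: "\<forall>d. ?value m d = ?value r d"
    have "poly_eval G s (monomial m - monomial r) = 0\<^sub>m (order G) (order G)"
      if s: "\<forall>(i, g) \<in> graded_vars G. s (i, g) \<in> crossed_component G \<phi> g"
      for s :: "'g graded_var \<Rightarrow> complex mat"
    proof -
      have "\<forall>x \<in> graded_vars G. \<exists>d. s x = graded_mat G \<phi> (snd x) d"
        using s by (fastforce simp: crossed_component_eq_graded_mats)
      then obtain d where "\<And>x. x \<in> graded_vars G \<Longrightarrow> s x = graded_mat G \<phi> (snd x) (d x)"
        by metis
      then show ?thesis
        using eval[of s d] eq diff_zero by simp
    qed
    then show "graded_identity G \<phi> (monomial m - monomial r)"
      using free by (simp add: graded_identity_def)
  qed
qed

section \<open>Graphs and graded identities\<close>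

lemma same_graph_imp_graded_identity:
  assumes "strongly_multilinear G m" "\<pi> permutes {..<length m}" "r = permute_list \<pi> m"
    and "same_graph G m r"
  shows "graded_identity G \<phi> (monomial m - monomial r)"
proof -
  have vars: "set m \<subseteq> graded_vars G" and dist: "distinct (map fst m)"
    using assms(1) by (auto simp: strongly_multilinear_def)
  then have "set r \<subseteq> graded_vars G"
    using assms(2,3) by simp
  moreover have "list_mult G (map snd m) = list_mult G (map snd r)"
    using same_graph_imp_same_total[OF dist assms(2)] assms(3,4) by simp
  moreover have "(\<Prod>j < length m. d (m ! j) (inv (initial_product G m j) \<otimes> h)) =
      (\<Prod>j < length r. d (r ! j) (inv (initial_product G r j) \<otimes> h))"
    for d :: "'g graded_var \<Rightarrow> 'g \<Rightarrow> complex" and h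
  proof -
    have "(\<Prod>j < length m. d (m ! j) (inv (initial_product G m j) \<otimes> h)) =
        (\<Prod>j < length m. d (m ! \<pi> j) (inv (initial_product G m (\<pi> j)) \<otimes> h))"
      using prod.permute[OF assms(2)] by (simp add: comp_def)
    also have "\<dots> = (\<Prod>j < length r. d (r ! j) (inv (initial_product G r j) \<otimes> h))"
      using assms same_graph_permute_list[OF dist assms(2), of G]
      by (intro prod.cong) (simp_all add: permute_list_nth)
    finally show ?thesis .
  qed
  ultimately show ?thesis
    using vars by (simp add: graded_identity_monomial_diff_iff)
qed

lemma graded_identity_imp_same_graph:
  assumes "strongly_multilinear G m" "\<pi> permutes {..<length m}" "r = permute_list \<pi> m"
    and "graded_identity G \<phi> (monomial m - monomial r)"
  shows "same_graph G m r"
proof -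
  have vars: "set m \<subseteq> graded_vars G" and dist: "distinct (map fst m)"
    using assms(1) by (auto simp: strongly_multilinear_def)
  then have degrees: "snd ` set m \<subseteq> carrier G"
    by (auto simp: graded_vars_def)
  have r: "set r = set m" "length r = length m"
    using assms(2,3) by simp_all
  have total: "list_mult G (map snd m) \<in> carrier G"
    using degrees by (intro list_mult_closed) auto
  \<comment> \<open>The entry at row \<open>\<one>\<close> and column \<open>(g\<^sub>1 \<cdots> g\<^sub>n)\<inverse>\<close> lies in the support of the value of \<open>m\<close>.\<close>
  obtain a where a: "a < order G" "\<phi> a = \<one>"
    using obtain_index[OF one_closed] by blast
  obtain b where b: "b < order G" "\<phi> b = inv (list_mult G (map snd m))"
    using obtain_index[OF inv_closed[OF total]] by blast
  have "initial_product G m (\<pi> j) = initial_product G r j" if j: "j < length m" for j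
  proof -
    define p where "p = initial_product G m (\<pi> j)"
    define d :: "'g graded_var \<Rightarrow> 'g \<Rightarrow> complex"
      where "d = (\<lambda>x h. if x = m ! \<pi> j \<and> h \<noteq> inv p then 0 else 1)"
    have \<pi>j: "\<pi> j < length m"
      using j permutes_in_image[OF assms(2), of j] by simp
    have p: "p \<in> carrier G" "initial_product G r j \<in> carrier G"
      unfolding p_def using degrees r by (simp_all add: initial_product_closed)
    let ?row = "\<lambda>w h. \<Prod>i < length w. d (w ! i) (inv (initial_product G w i) \<otimes> h)"
    have entry: "graded_mat G \<phi> g f $$ (a, b) = (if \<one> = g \<otimes> \<phi> b then f \<one> else 0)" for g f
      using a b by (simp add: graded_mat_def)
    have "d (m ! i) (inv (initial_product G m i) \<otimes> \<one>) = 1" if "i < length m" for i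
      using that \<pi>j dist degrees nth_eq_iff_index_eq[of m i "\<pi> j"]
      by (auto simp: d_def p_def initial_product_closed distinct_map)
    then have "graded_mat G \<phi> (list_mult G (map snd m)) (?row m) $$ (a, b) = 1"
      using b total by (simp add: entry)
    moreover have "graded_mat G \<phi> (list_mult G (map snd m)) (?row m) =
        graded_mat G \<phi> (list_mult G (map snd r)) (?row r)"
      using assms(4) vars r by (simp add: graded_identity_monomial_diff_iff)
    ultimately have "graded_mat G \<phi> (list_mult G (map snd r)) (?row r) $$ (a, b) = 1"
      by simp
    then have "?row r \<one> = 1"
      unfolding entry by (simp only: zero_neq_one split: if_splits)
    then have "?row r \<one> \<noteq> 0"
      by (simp only: one_neq_zero not_False_eq_True)
    then have "d (r ! j) (inv (initial_product G r j) \<otimes> \<one>) \<noteq> 0"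
      using j r by auto
    moreover have "r ! j = m ! \<pi> j"
      using assms(2,3) j by (simp add: permute_list_nth)
    ultimately have "inv (initial_product G r j) = inv p"
      using p by (auto simp: d_def split: if_splits)
    then show ?thesis
      using p by (metis p_def inv_inv)
  qed
  then show ?thesis
    using same_graph_iff_end_points(2)[OF dist degrees assms(2)] assms(3) by simp
qed

end

theorem corollary6:
  fixes G :: "('g, 'b) monoid_scheme"
    and \<phi> :: "nat \<Rightarrow> 'g"
    and m r :: "'g graded_var list"
    and \<pi> :: "nat \<Rightarrow> nat"
  assumes "group G" and "finite (carrier G)"
    and "bij_betw \<phi> {..<order G} (carrier G)"
    and "strongly_multilinear G m"
    and "\<pi> permutes {..<length m}"
    and "r = permute_list \<pi> m"
  shows "(equivalent_monomials G m r \<longleftrightarrow> same_graph G m r) \<and>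
         (same_graph G m r \<longleftrightarrow> graded_identity G \<phi> (monomial m - monomial r))"
proof -
  interpret group G
    by (rule assms(1))
  interpret enumerated_group G \<phi>
    by unfold_locales (rule assms(3))
  have "distinct (map fst m)" "snd ` set m \<subseteq> carrier G"
    using assms(4) by (auto simp: strongly_multilinear_def graded_vars_def)
  then show ?thesis
    using assms(4-6) equivalent_monomials_iff_same_graph[of m \<pi>]
      same_graph_imp_graded_identity[of m \<pi> r] graded_identity_imp_same_graph[of m \<pi> r]
    by metis
qed

end
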